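(* For any nontrivial finite subgroup $\Gamma\subset\operatorname{Aut}(\mathbb D)$, the regular part of $\mathbb D/\Gamma$ is biholomorphic to $\mathbb D\setminus\{0\}$.
   Context: $\mathbb D$ is the unit disc in $\mathbb C$ and $\operatorname{Aut}(\mathbb D)$ is its group of holomorphic automorphisms. The quotient $\mathbb D/\Gamma$ is regarded as a Stein space with exactly one isolated singular point, namely the image of the common fixed point of $\Gamma$ in $\mathbb D$ (the branch point of the quotient map $\mathbb D\to\mathbb D/\Gamma$). Its regular part is the complement of that point, i.e. the quotient Riemann surface $(\mathbb D\setminus\{a\})/\Gamma$, where $a$ is the common fixed point of $\Gamma$ ($a=0$ after conjugating $\Gamma$ by an automorphism of $\mathbb D$). *)

theory Defs
  imports "HOL-Complex_Analysis.Complex_Analysis" "HOL-Algebra.Group_Action"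
begin

section \<open>Riemann surfaces\<close>

text \<open>
  A point set with a topology and a set of complex charts. A chart is a pair of its domain and
  its coordinate function; the values of the coordinate function off its domain are irrelevant.
\<close>

record 'a surface =
  surf_top :: "'a topology"
  charts :: "('a set \<times> ('a \<Rightarrow> complex)) set"

definition complex_atlas :: "'a topology \<Rightarrow> ('a set \<times> ('a \<Rightarrow> complex)) set \<Rightarrow> bool" where
  "complex_atlas X A \<longleftrightarrow>
     (\<Union>(U, \<phi>)\<in>A. U) = topspace X \<and>
     (\<forall>(U, \<phi>)\<in>A. openin X U \<and> open (\<phi> ` U) \<and>
        homeomorphic_map (subtopology X U) (top_of_set (\<phi> ` U)) \<phi>) \<and>
     (\<forall>(U, \<phi>)\<in>A. \<forall>(V, \<psi>)\<in>A. (\<psi> \<circ> inv_into U \<phi>) holomorphic_on \<phi> ` (U \<inter> V))"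

text \<open>
  Second countability is automatic for connected Hausdorff surfaces (Rado's theorem); it is
  included so that the definition agrees with every common convention.
\<close>

definition riemann_surface :: "'a surface \<Rightarrow> bool" where
  "riemann_surface X \<longleftrightarrow>
     topspace (surf_top X) \<noteq> {} \<and> connected_space (surf_top X) \<and> Hausdorff_space (surf_top X) \<and>
     second_countable (surf_top X) \<and> complex_atlas (surf_top X) (charts X)"

definition holomorphic_surface_map :: "'a surface \<Rightarrow> 'b surface \<Rightarrow> ('a \<Rightarrow> 'b) \<Rightarrow> bool" where
  "holomorphic_surface_map X Y f \<longleftrightarrow>
     continuous_map (surf_top X) (surf_top Y) f \<and>
     (\<forall>(U, \<phi>)\<in>charts X. \<forall>(V, \<psi>)\<in>charts Y.
        (\<psi> \<circ> f \<circ> inv_into U \<phi>) holomorphic_on \<phi> ` {x \<in> U. f x \<in> V})"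

definition biholomorphic_surfaces :: "'a surface \<Rightarrow> 'b surface \<Rightarrow> bool" where
  "biholomorphic_surfaces X Y \<longleftrightarrow>
     riemann_surface X \<and> riemann_surface Y \<and>
     (\<exists>f g. holomorphic_surface_map X Y f \<and> holomorphic_surface_map Y X g \<and>
        (\<forall>x\<in>topspace (surf_top X). g (f x) = x) \<and>
        (\<forall>y\<in>topspace (surf_top Y). f (g y) = y))"

definition plane_surface :: "complex set \<Rightarrow> complex surface" where
  "plane_surface S = \<lparr>surf_top = top_of_set S, charts = {(S, \<lambda>z. z)}\<rparr>"


section \<open>Automorphisms of the disc\<close>

abbreviation unit_disc :: "complex set" where
  "unit_disc \<equiv> ball 0 1"

text \<open>
  As in \<^const>\<open>BijGroup\<close>, the elements are extensional functions, so that equality in the group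
  is equality of maps on the disc.
\<close>

definition Aut_disc :: "(complex \<Rightarrow> complex) monoid" where
  "Aut_disc = BijGroup unit_disc
     \<lparr>carrier := {f \<in> Bij unit_disc. f holomorphic_on unit_disc \<and>
                   inv_into unit_disc f holomorphic_on unit_disc}\<rparr>"

lemma subgroup_Aut_disc:
  "subgroup {f \<in> Bij unit_disc. f holomorphic_on unit_disc \<and>
       inv_into unit_disc f holomorphic_on unit_disc} (BijGroup unit_disc)"
proof -
  let ?D = unit_disc
  let ?H = "{f \<in> Bij ?D. f holomorphic_on ?D \<and> inv_into ?D f holomorphic_on ?D}"
  have bij: "bij_betw f ?D ?D" if "f \<in> Bij ?D" for f
    using that by (simp add: Bij_def)
  have into: "inv_into ?D f z \<in> ?D" if "f \<in> Bij ?D" "z \<in> ?D" for f z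
    using that by (rule Bij_inv_into_mem)
  interpret group "BijGroup ?D" by (rule group_BijGroup)
  show ?thesis
  proof (rule subgroupI)
    show "?H \<subseteq> carrier (BijGroup ?D)"
      by (auto simp: BijGroup_def)
    have "(\<lambda>z\<in>?D. z) \<in> ?H"
    proof -
      have "(\<lambda>z. z) holomorphic_on ?D" by (rule holomorphic_on_ident)
      then have "(\<lambda>z\<in>?D. z) holomorphic_on ?D"
        by (rule holomorphic_transform) auto
      moreover have "inv_into ?D (\<lambda>z\<in>?D. z) holomorphic_on ?D"
      proof (rule holomorphic_transform [OF holomorphic_on_ident])
        fix z :: complex assume z: "z \<in> ?D"
        show "z = inv_into ?D (\<lambda>z\<in>?D. z) z"
          using inv_into_f_f [OF bij_betw_imp_inj_on [OF bij [OF id_Bij]] z] z by simp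
      qed
      ultimately show ?thesis by (simp add: id_Bij)
    qed
    then show "?H \<noteq> {}" by blast
  next
    fix f assume f: "f \<in> ?H"
    then have fB: "f \<in> Bij ?D" by simp
    have inv: "inv\<^bsub>BijGroup ?D\<^esub> f = (\<lambda>z\<in>?D. inv_into ?D f z)"
      using fB by (rule inv_BijGroup)
    have "(\<lambda>z\<in>?D. inv_into ?D f z) \<in> Bij ?D"
      using fB by (rule restrict_inv_into_Bij)
    moreover have "(\<lambda>z\<in>?D. inv_into ?D f z) holomorphic_on ?D"
      by (rule holomorphic_transform [of "inv_into ?D f"]) (use f in auto)
    moreover have "inv_into ?D (\<lambda>z\<in>?D. inv_into ?D f z) holomorphic_on ?D"
    proof (rule holomorphic_transform [of f])
      show "f holomorphic_on ?D" using f by simp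
      fix z assume z: "z \<in> ?D"
      have fz: "f z \<in> ?D"
        by (rule funcset_mem [OF Bij_imp_funcset [OF fB] z])
      have inj: "inj_on (\<lambda>z\<in>?D. inv_into ?D f z) ?D"
        by (rule bij_betw_imp_inj_on [OF bij [OF restrict_inv_into_Bij [OF fB]]])
      have "inv_into ?D f (f z) = z"
        using bij_betw_imp_inj_on [OF bij [OF fB]] z by (rule inv_into_f_f)
      with fz have "(\<lambda>z\<in>?D. inv_into ?D f z) (f z) = z" by simp
      then show "f z = inv_into ?D (\<lambda>z\<in>?D. inv_into ?D f z) z"
        using inv_into_f_f [OF inj fz] by simp
    qed
    ultimately show "inv\<^bsub>BijGroup ?D\<^esub> f \<in> ?H"
      unfolding inv by blast
  next
    fix f g assume f: "f \<in> ?H" and g: "g \<in> ?H"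
    then have fB: "f \<in> Bij ?D" and gB: "g \<in> Bij ?D" by simp_all
    have mult: "f \<otimes>\<^bsub>BijGroup ?D\<^esub> g = compose ?D f g"
      using fB gB by (simp add: BijGroup_def)
    have cB: "compose ?D f g \<in> Bij ?D"
      using fB gB by (rule compose_Bij)
    have gD: "g z \<in> ?D" if "z \<in> ?D" for z
      by (rule funcset_mem [OF Bij_imp_funcset [OF gB] that])
    have "(f \<circ> g) holomorphic_on ?D"
      by (rule holomorphic_on_compose_gen [of g ?D f ?D]) (use f g gD in auto)
    then have "compose ?D f g holomorphic_on ?D"
      by (rule holomorphic_transform) (auto simp: compose_def)
    moreover have "(inv_into ?D g \<circ> inv_into ?D f) holomorphic_on ?D"
      by (rule holomorphic_on_compose_gen [of "inv_into ?D f" ?D _ ?D]) (use f g into [OF fB] in auto)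
    then have "inv_into ?D (compose ?D f g) holomorphic_on ?D"
    proof (rule holomorphic_transform)
      fix z assume z: "z \<in> ?D"
      let ?w = "inv_into ?D g (inv_into ?D f z)"
      have w: "?w \<in> ?D" using into [OF gB into [OF fB z]] .
      have "compose ?D f g ?w = z"
        using w z into [OF fB z] bij [OF fB] bij [OF gB]
        by (simp only: compose_eq bij_betw_inv_into_right)
      then show "(inv_into ?D g \<circ> inv_into ?D f) z = inv_into ?D (compose ?D f g) z"
        using inv_into_f_f [OF bij_betw_imp_inj_on [OF bij [OF cB]] w] by simp
    qed
    ultimately show "f \<otimes>\<^bsub>BijGroup ?D\<^esub> g \<in> ?H"
      unfolding mult using cB by blast
  qed
qed

lemma group_Aut_disc: "group Aut_disc"
  unfolding Aut_disc_def
  using subgroup.subgroup_is_group [OF subgroup_Aut_disc group_BijGroup] .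


section \<open>Quotient surfaces\<close>

text \<open>
  \<open>G\<close> is a group of transformations acting on an open set \<open>S\<close> by evaluation. The points of the
  quotient are the orbits, the topology is the quotient topology, and the charts are the inverses
  of the quotient map restricted to open sets on which it is injective. These charts cover the
  quotient when the action is free and properly discontinuous.
\<close>

definition orbit_map :: "(complex \<Rightarrow> complex) monoid \<Rightarrow> complex \<Rightarrow> complex set" where
  "orbit_map G z = orbit G (\<lambda>g. g) z"

definition quotient_top :: "(complex \<Rightarrow> complex) monoid \<Rightarrow> complex set \<Rightarrow> complex set topology" where
  "quotient_top G S = topology (\<lambda>U. U \<subseteq> orbit_map G ` S \<and>
     openin (top_of_set S) {z \<in> S. orbit_map G z \<in> U})"

lemma openin_quotient_top:
  "openin (quotient_top G S) U \<longleftrightarrow>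
     U \<subseteq> orbit_map G ` S \<and> openin (top_of_set S) {z \<in> S. orbit_map G z \<in> U}"
proof -
  have "istopology (\<lambda>U. U \<subseteq> orbit_map G ` S \<and>
          openin (top_of_set S) {z \<in> S. orbit_map G z \<in> U})"
    unfolding istopology_def
  proof (intro conjI allI impI; (elim conjE)?)
    fix U V
    assume "openin (top_of_set S) {z \<in> S. orbit_map G z \<in> U}"
      and "openin (top_of_set S) {z \<in> S. orbit_map G z \<in> V}"
    then have "openin (top_of_set S) ({z \<in> S. orbit_map G z \<in> U} \<inter> {z \<in> S. orbit_map G z \<in> V})"
      by (rule openin_Int)
    moreover have "{z \<in> S. orbit_map G z \<in> U} \<inter> {z \<in> S. orbit_map G z \<in> V} =
        {z \<in> S. orbit_map G z \<in> U \<inter> V}"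
      by blast
    ultimately show "openin (top_of_set S) {z \<in> S. orbit_map G z \<in> U \<inter> V}"
      by simp
  next
    fix \<K>
    assume K: "\<forall>U\<in>\<K>. U \<subseteq> orbit_map G ` S \<and>
                 openin (top_of_set S) {z \<in> S. orbit_map G z \<in> U}"
    then have "openin (top_of_set S) (\<Union>U\<in>\<K>. {z \<in> S. orbit_map G z \<in> U})"
      by blast
    moreover have "(\<Union>U\<in>\<K>. {z \<in> S. orbit_map G z \<in> U}) = {z \<in> S. orbit_map G z \<in> \<Union>\<K>}"
      by blast
    ultimately show "openin (top_of_set S) {z \<in> S. orbit_map G z \<in> \<Union>\<K>}"
      by simp
  qed blast+
  then show ?thesis
    by (simp add: quotient_top_def topology_inverse')
qed

lemma topspace_quotient_top: "topspace (quotient_top G S) = orbit_map G ` S"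
proof (rule antisym)
  show "topspace (quotient_top G S) \<subseteq> orbit_map G ` S"
    using openin_quotient_top openin_topspace by blast
  have "{z \<in> S. orbit_map G z \<in> orbit_map G ` S} = S" by blast
  then have "openin (quotient_top G S) (orbit_map G ` S)"
    by (simp add: openin_quotient_top)
  then show "orbit_map G ` S \<subseteq> topspace (quotient_top G S)"
    by (rule openin_subset)
qed

lemma quotient_map_orbit_map: "quotient_map (top_of_set S) (quotient_top G S) (orbit_map G)"
  by (auto simp: quotient_map_def topspace_quotient_top openin_quotient_top)

definition quotient_surface :: "(complex \<Rightarrow> complex) monoid \<Rightarrow> complex set \<Rightarrow> complex set surface" where
  "quotient_surface G S =
     \<lparr>surf_top = quotient_top G S,
      charts = {(orbit_map G ` W, inv_into W (orbit_map G)) | W.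
                  W \<subseteq> S \<and> open W \<and> inj_on (orbit_map G) W}\<rparr>"

text \<open>
  Well defined for nontrivial finite subgroups, by \<open>ex1_common_fixed_point\<close> below.
\<close>

definition common_fixed_point :: "(complex \<Rightarrow> complex) set \<Rightarrow> complex" where
  "common_fixed_point \<Gamma> = (THE a. a \<in> unit_disc \<and> (\<forall>g\<in>\<Gamma>. g a = a))"

definition regular_part :: "(complex \<Rightarrow> complex) set \<Rightarrow> complex set surface" where
  "regular_part \<Gamma> =
     quotient_surface (Aut_disc\<lparr>carrier := \<Gamma>\<rparr>) (unit_disc - {common_fixed_point \<Gamma>})"


section \<open>The common fixed point\<close>

text \<open>
  Existence: with \<open>\<rho>\<close> the pseudohyperbolic distance, the function sending \<open>z\<close> to the sum of
  \<open>1 / (1 - \<rho>(z, g 0)\<^sup>2)\<close> over \<open>g\<close> in the group is invariant and has exactly one minimum point.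
  Uniqueness is the Schwarz lemma.
\<close>

lemma norm_cnj_mult_diff_pos:
  assumes "norm w < 1" and "norm z < 1"
  shows "norm (1 - cnj w * z) > 0"
proof -
  have "norm (cnj w * z) < 1"
    using assms norm_mult_less [of "cnj w" 1 z 1] by simp
  then have "cnj w * z \<noteq> 1" by auto
  then show ?thesis by simp
qed

lemma one_minus_norm_Moebius:
  assumes "norm w < 1" and "norm z < 1"
  shows "1 - (norm (Moebius_function 0 w z))\<^sup>2 =
    (1 - (norm w)\<^sup>2) * (1 - (norm z)\<^sup>2) / (norm (1 - cnj w * z))\<^sup>2"
proof -
  have pos: "norm (1 - cnj w * z) > 0"
    using assms by (rule norm_cnj_mult_diff_pos)
  have "(norm (1 - cnj w * z))\<^sup>2 - (norm (z - w))\<^sup>2 = (1 - (norm w)\<^sup>2) * (1 - (norm z)\<^sup>2)"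
    by (simp only: cmod_power2) (simp add: algebra_simps power2_eq_square)
  then show ?thesis
    using pos by (simp add: Moebius_function_simple norm_divide power_divide field_simps)
qed

lemma Schwarz_Pick_le:
  assumes hol: "f holomorphic_on unit_disc" and into: "\<And>z. z \<in> unit_disc \<Longrightarrow> f z \<in> unit_disc"
    and w: "w \<in> unit_disc" and z: "z \<in> unit_disc"
  shows "norm (Moebius_function 0 (f w) (f z)) \<le> norm (Moebius_function 0 w z)"
proof -
  define h where "h = Moebius_function 0 (f w) \<circ> (f \<circ> Moebius_function 0 (- w))"
  have fw: "norm (f w) < 1" using into [OF w] by simp
  have M: "norm (Moebius_function 0 (- w) \<zeta>) < 1" if "norm \<zeta> < 1" for \<zeta>
    using that w by (intro Moebius_function_norm_lt_1) auto
  have "(f \<circ> Moebius_function 0 (- w)) holomorphic_on unit_disc"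
    by (rule holomorphic_on_compose_gen [OF Moebius_function_holomorphic hol]) (use w M in auto)
  then have "h holomorphic_on unit_disc"
    unfolding h_def
    by (rule holomorphic_on_compose_gen [OF _ Moebius_function_holomorphic [OF fw]])
       (use into M in fastforce)
  moreover have "h 0 = 0"
    by (simp add: h_def Moebius_function_of_zero Moebius_function_eq_zero)
  moreover have "norm (h \<zeta>) < 1" if "norm \<zeta> < 1" for \<zeta>
    using into [of "Moebius_function 0 (- w) \<zeta>"] M [OF that] fw
    by (auto simp: h_def intro!: Moebius_function_norm_lt_1)
  moreover have "norm (Moebius_function 0 w z) < 1"
    using w z by (intro Moebius_function_norm_lt_1) auto
  ultimately have "norm (h (Moebius_function 0 w z)) \<le> norm (Moebius_function 0 w z)"
    by (rule Schwarz_Lemma(1))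
  moreover have "Moebius_function 0 (- w) (Moebius_function 0 w z) = z"
    using w z by (intro Moebius_function_compose) auto
  ultimately show ?thesis by (simp add: h_def)
qed

lemma carrier_Aut_disc:
  "f \<in> carrier Aut_disc \<longleftrightarrow> f \<in> Bij unit_disc \<and> f holomorphic_on unit_disc \<and>
     inv_into unit_disc f holomorphic_on unit_disc"
  by (simp add: Aut_disc_def)

lemma Aut_disc_in_disc: "f \<in> carrier Aut_disc \<Longrightarrow> z \<in> unit_disc \<Longrightarrow> f z \<in> unit_disc"
  unfolding carrier_Aut_disc by (blast intro: funcset_mem [OF Bij_imp_funcset])

lemma Schwarz_Pick_Aut_disc:
  assumes f: "f \<in> carrier Aut_disc" and w: "w \<in> unit_disc" and z: "z \<in> unit_disc"
  shows "norm (Moebius_function 0 (f w) (f z)) = norm (Moebius_function 0 w z)"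
proof (rule antisym)
  have fB: "f \<in> Bij unit_disc" and hol: "f holomorphic_on unit_disc"
    and hol': "inv_into unit_disc f holomorphic_on unit_disc"
    using f by (simp_all add: carrier_Aut_disc)
  then have inj: "inj_on f unit_disc"
    by (auto simp: Bij_def bij_betw_def)
  show "norm (Moebius_function 0 (f w) (f z)) \<le> norm (Moebius_function 0 w z)"
    using hol Aut_disc_in_disc [OF f] w z by (rule Schwarz_Pick_le)
  have "norm (Moebius_function 0 (inv_into unit_disc f (f w)) (inv_into unit_disc f (f z)))
      \<le> norm (Moebius_function 0 (f w) (f z))"
    using hol' Bij_inv_into_mem [OF fB] Aut_disc_in_disc [OF f w] Aut_disc_in_disc [OF f z]
    by (rule Schwarz_Pick_le)
  then show "norm (Moebius_function 0 w z) \<le> norm (Moebius_function 0 (f w) (f z))"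
    using inv_into_f_f [OF inj w] inv_into_f_f [OF inj z] by simp
qed

lemma ex1_minimum_disc:
  fixes B :: complex and P :: real
  assumes PB: "2 * norm B < P"
  defines "Q \<equiv> \<lambda>z. (P - 2 * Re (cnj B * z)) / (1 - (norm z)\<^sup>2)"
  shows "\<exists>!a. a \<in> unit_disc \<and> (\<forall>z\<in>unit_disc. Q a \<le> Q z)"
proof -
  define \<delta> where "\<delta> = P - 2 * norm B"
  have \<delta>: "\<delta> > 0" and P: "P > 0"
    using PB norm_ge_zero [of B] unfolding \<delta>_def by linarith+
  have pos: "1 - (norm z)\<^sup>2 > 0" if "z \<in> unit_disc" for z :: complex
    using that by (simp add: abs_square_less_1)
  have num: "P - 2 * Re (cnj B * z) > 0 \<and> P - 2 * Re (cnj B * z) \<ge> \<delta>" if "z \<in> unit_disc" for z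
  proof -
    have "Re (cnj B * z) \<le> norm (cnj B * z)" by (rule complex_Re_le_cmod)
    also have "\<dots> \<le> norm B"
      using that by (simp add: norm_mult mult_left_le)
    finally show ?thesis using \<delta> unfolding \<delta>_def by linarith
  qed
  define r where "r = sqrt (max 0 (1 - \<delta> / P))"
  have "max 0 (1 - \<delta> / P) < 1" using \<delta> P by simp
  then have r: "0 \<le> r" "r < 1" and r2: "r\<^sup>2 \<ge> 1 - \<delta> / P"
    unfolding r_def using real_sqrt_less_mono [of "max 0 (1 - \<delta> / P)" 1] by auto
  have large: "Q z \<ge> Q 0" if z: "z \<in> unit_disc" "norm z > r" for z
  proof -
    have "(norm z)\<^sup>2 \<ge> r\<^sup>2" using z r by (intro power_mono) auto
    then have "1 - (norm z)\<^sup>2 \<le> \<delta> / P" using r2 by linarith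
    then have "P * (1 - (norm z)\<^sup>2) \<le> \<delta>" using P by (simp add: field_simps)
    also have "\<dots> \<le> P - 2 * Re (cnj B * z)" using num z by blast
    finally show ?thesis using pos [OF z(1)] by (simp add: Q_def pos_le_divide_eq)
  qed
  have sub: "cball 0 r \<subseteq> unit_disc" using r by auto
  have "continuous_on (cball 0 r) Q"
    unfolding Q_def using pos sub by (intro continuous_intros) force
  then obtain a where a: "a \<in> cball 0 r" and amin: "\<And>z. z \<in> cball 0 r \<Longrightarrow> Q a \<le> Q z"
    using continuous_attains_inf [of "cball 0 r" Q] r by auto
  have "Q a \<le> Q z" if "z \<in> unit_disc" for z
  proof (cases "norm z > r")
    case True
    then show ?thesis using large [OF that] amin [of 0] r by simp
  qed (use amin in auto)
  then have ex: "a \<in> unit_disc \<and> (\<forall>z\<in>unit_disc. Q a \<le> Q z)" using a sub by blast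
  show ?thesis
  proof (rule ex1I [where a = a])
    show "a \<in> unit_disc \<and> (\<forall>z\<in>unit_disc. Q a \<le> Q z)" by (rule ex)
    fix b assume b: "b \<in> unit_disc \<and> (\<forall>z\<in>unit_disc. Q b \<le> Q z)"
    define m where "m = Q a"
    have mb: "Q b = m" using ex b unfolding m_def by (auto intro: antisym)
    have m: "m > 0"
      using num [of a] pos [of a] ex unfolding m_def Q_def by simp
    define c where "c = (a + b) / 2"
    have c: "c \<in> unit_disc"
      using convexD [OF convex_ball, of a 0 1 b "1/2" "1/2"] ex b
      by (simp add: c_def scaleR_conv_of_real field_simps)
    have "m \<le> Q c" using ex c unfolding m_def by blast
    then have 1: "m * (1 - (norm c)\<^sup>2) \<le> P - 2 * Re (cnj B * c)"
      using pos [OF c] by (simp add: Q_def pos_le_divide_eq)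
    have 2: "m * (1 - (norm a)\<^sup>2) = P - 2 * Re (cnj B * a)"
      using pos [of a] ex by (simp add: m_def Q_def)
    have 3: "m * (1 - (norm b)\<^sup>2) = P - 2 * Re (cnj B * b)"
      using pos [of b] b by (simp add: mb [symmetric] Q_def)
    have 4: "Re (cnj B * c) = (Re (cnj B * a) + Re (cnj B * b)) / 2"
      by (simp add: c_def field_simps)
    have 5: "(norm c)\<^sup>2 = ((norm a)\<^sup>2 + (norm b)\<^sup>2) / 2 - (norm (a - b))\<^sup>2 / 4"
      unfolding c_def by (simp only: cmod_power2) (simp add: power2_eq_square field_simps)
    have "m * (norm (a - b))\<^sup>2 \<le> 0"
    proof -
      have "m * (1 - (norm c)\<^sup>2) =
          (m * (1 - (norm a)\<^sup>2) + m * (1 - (norm b)\<^sup>2)) / 2 + m * (norm (a - b))\<^sup>2 / 4"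
        unfolding 5 by (simp add: field_simps)
      moreover have "M \<le> P - 2 * R \<Longrightarrow> Ma = P - 2 * Ra \<Longrightarrow> Mb = P - 2 * Rb \<Longrightarrow>
          R = (Ra + Rb) / 2 \<Longrightarrow> M = (Ma + Mb) / 2 + d / 4 \<Longrightarrow> d \<le> 0"
        for M Ma Mb R Ra Rb d :: real
        by (simp add: field_simps)
      ultimately show ?thesis using 1 2 3 4 by blast
    qed
    then have "(norm (a - b))\<^sup>2 \<le> 0"
      using m by (simp add: mult_le_0_iff)
    then show "b = a" by simp
  qed
qed

lemma Aut_disc_two_fixed_points:
  assumes f: "f \<in> carrier Aut_disc" and a: "a \<in> unit_disc" "f a = a"
    and b: "b \<in> unit_disc" "f b = b" and ab: "a \<noteq> b"
  shows "f = \<one>\<^bsub>Aut_disc\<^esub>"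
proof -
  define h where "h = Moebius_function 0 a \<circ> (f \<circ> Moebius_function 0 (- a))"
  have na: "norm a < 1" using a by simp
  have M: "norm (Moebius_function 0 (- a) \<zeta>) < 1" if "norm \<zeta> < 1" for \<zeta>
    using that na by (intro Moebius_function_norm_lt_1) auto
  have MM: "Moebius_function 0 (- a) (Moebius_function 0 a \<zeta>) = \<zeta>" if "norm \<zeta> < 1" for \<zeta>
    using that na by (intro Moebius_function_compose) auto
  have M1: "norm (Moebius_function 0 a \<zeta>) < 1" if "norm \<zeta> < 1" for \<zeta>
    using that na by (intro Moebius_function_norm_lt_1) auto
  have hol: "f holomorphic_on unit_disc" using f by (simp add: carrier_Aut_disc)
  have into: "norm (f \<zeta>) < 1" if "norm \<zeta> < 1" for \<zeta>
    using Aut_disc_in_disc [OF f, of \<zeta>] that by simp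
  have "(f \<circ> Moebius_function 0 (- a)) holomorphic_on unit_disc"
    by (rule holomorphic_on_compose_gen [OF Moebius_function_holomorphic hol]) (use na M in auto)
  then have "h holomorphic_on unit_disc"
    unfolding h_def
    by (rule holomorphic_on_compose_gen [OF _ Moebius_function_holomorphic [OF na]])
       (use into M in fastforce)
  moreover have "h 0 = 0"
    using a by (simp add: h_def Moebius_function_of_zero Moebius_function_eq_zero)
  moreover have "norm (h \<zeta>) < 1" if "norm \<zeta> < 1" for \<zeta>
    using into M M1 that by (simp add: h_def)
  moreover have mb: "norm (Moebius_function 0 a b) < 1" using M1 b by simp
  moreover have b0: "Moebius_function 0 a b \<noteq> 0"
    using MM [of b] MM [of a] a b ab by (auto simp: Moebius_function_eq_zero)
  moreover have hb: "h (Moebius_function 0 a b) = Moebius_function 0 a b"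
    using MM [of b] b by (simp add: h_def)
  ultimately obtain \<alpha> where \<alpha>: "\<And>\<zeta>. norm \<zeta> < 1 \<Longrightarrow> h \<zeta> = \<alpha> * \<zeta>"
    using Schwarz_Lemma(3) [of h "Moebius_function 0 a b"] by metis
  then have "\<alpha> = 1" using hb b0 mb by fastforce
  have "f z = z" if "z \<in> unit_disc" for z
  proof -
    have z: "norm z < 1" using that by simp
    have "Moebius_function 0 a (f z) = Moebius_function 0 a z"
      using \<alpha> [OF M1 [OF z]] \<open>\<alpha> = 1\<close> MM [OF z] by (simp add: h_def)
    then show ?thesis using MM [OF z] MM [OF into [OF z]] by metis
  qed
  moreover have "f \<in> extensional unit_disc"
    using f by (simp add: carrier_Aut_disc Bij_def)
  ultimately have "f = (\<lambda>z\<in>unit_disc. z)"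
    by (intro extensionalityI [of _ unit_disc]) auto
  then show ?thesis by (simp add: Aut_disc_def BijGroup_def)
qed

theorem ex1_common_fixed_point:
  assumes "subgroup \<Gamma> Aut_disc" and "finite \<Gamma>" and "\<Gamma> \<noteq> {\<one>\<^bsub>Aut_disc\<^esub>}"
  shows "\<exists>!a. a \<in> unit_disc \<and> (\<forall>g\<in>\<Gamma>. g a = a)"
proof -
  interpret A: group Aut_disc by (rule group_Aut_disc)
  interpret \<Gamma>: subgroup \<Gamma> Aut_disc by (rule assms(1))
  have car: "g \<in> carrier Aut_disc" if "g \<in> \<Gamma>" for g
    using that by (rule \<Gamma>.mem_carrier)
  have mult: "(g \<otimes>\<^bsub>Aut_disc\<^esub> k) z = g (k z)" if "g \<in> \<Gamma>" "k \<in> \<Gamma>" "z \<in> unit_disc" for g k z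
    using car [OF that(1)] car [OF that(2)] that(3)
    by (simp add: carrier_Aut_disc) (simp add: Aut_disc_def BijGroup_def compose_eq)
  define F where "F = (\<lambda>z. \<Sum>g\<in>\<Gamma>. 1 / (1 - (norm (Moebius_function 0 (g 0) z))\<^sup>2))"
  define d where "d = (\<lambda>g::complex \<Rightarrow> complex. 1 - (norm (g 0))\<^sup>2)"
  define P where "P = (\<Sum>g\<in>\<Gamma>. (1 + (norm (g 0))\<^sup>2) / d g)"
  define B where "B = (\<Sum>g\<in>\<Gamma>. g 0 / of_real (d g))"
  define C where "C = (\<Sum>g\<in>\<Gamma>. (norm (g 0))\<^sup>2 / d g)"
  define Q where "Q = (\<lambda>z. (P - 2 * Re (cnj B * z)) / (1 - (norm z)\<^sup>2))"
  have n0: "norm (g 0) < 1" if "g \<in> \<Gamma>" for g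
    using Aut_disc_in_disc [OF car [OF that], of 0] by simp
  have d: "d g > 0" if "g \<in> \<Gamma>" for g
    using n0 [OF that] by (simp add: d_def abs_square_less_1)
  have FQ: "F z = Q z - C" if z: "z \<in> unit_disc" for z
  proof -
    have nz: "norm z < 1" using z by simp
    have dz: "1 - (norm z)\<^sup>2 > 0" using nz by (simp add: abs_square_less_1)
    have "1 / (1 - (norm (Moebius_function 0 (g 0) z))\<^sup>2) =
        ((1 + (norm (g 0))\<^sup>2) / d g - 2 * Re (cnj (g 0 / of_real (d g)) * z)) / (1 - (norm z)\<^sup>2)
          - (norm (g 0))\<^sup>2 / d g" if g: "g \<in> \<Gamma>" for g
    proof -
      have e: "(norm (1 - cnj (g 0) * z))\<^sup>2 =
          (1 + (norm (g 0))\<^sup>2 - 2 * Re (cnj (g 0) * z)) - (norm (g 0))\<^sup>2 * (1 - (norm z)\<^sup>2)"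
        by (simp only: cmod_power2) (simp add: algebra_simps power2_eq_square)
      have r: "Re (cnj (g 0 / of_real (d g)) * z) = Re (cnj (g 0) * z) / d g"
        by (simp add: add_divide_distrib)
      have "1 / (1 - (norm (Moebius_function 0 (g 0) z))\<^sup>2) =
          (norm (1 - cnj (g 0) * z))\<^sup>2 / (d g * (1 - (norm z)\<^sup>2))"
        by (simp add: one_minus_norm_Moebius [OF n0 [OF g] nz] d_def)
      also have "\<dots> = ((1 + (norm (g 0))\<^sup>2) / d g - 2 * (Re (cnj (g 0) * z) / d g)) / (1 - (norm z)\<^sup>2)
          - (norm (g 0))\<^sup>2 / d g"
        unfolding e using d [OF g] dz
        by (simp add: diff_divide_distrib add_divide_distrib mult.commute)
      finally show ?thesis unfolding r .
    qed
    then have "F z = (\<Sum>g\<in>\<Gamma>. ((1 + (norm (g 0))\<^sup>2) / d g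
        - 2 * Re (cnj (g 0 / of_real (d g)) * z)) / (1 - (norm z)\<^sup>2) - (norm (g 0))\<^sup>2 / d g)"
      unfolding F_def by (rule sum.cong [OF refl])
    also have "\<dots> = Q z - C"
      unfolding Q_def P_def B_def C_def
      by (simp only: sum_subtractf sum_divide_distrib [symmetric] sum_distrib_left [symmetric]
            Re_sum [symmetric] sum_distrib_right [symmetric] cnj_sum [symmetric])
    finally show ?thesis .
  qed
  have PB: "2 * norm B < P"
  proof -
    have "2 * norm B \<le> 2 * (\<Sum>g\<in>\<Gamma>. norm (g 0 / of_real (d g)))"
      unfolding B_def using norm_sum by (intro mult_left_mono) auto
    also have "\<dots> = (\<Sum>g\<in>\<Gamma>. 2 * norm (g 0) / d g)"
      unfolding sum_distrib_left using d by (intro sum.cong) (auto simp: norm_divide abs_of_pos)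
    also have "\<dots> < P"
      unfolding P_def
    proof (rule sum_strict_mono)
      show "\<Gamma> \<noteq> {}" using \<Gamma>.one_closed by blast
      fix g assume g: "g \<in> \<Gamma>"
      have "(1 - norm (g 0))\<^sup>2 > 0" using n0 [OF g] by simp
      then have "2 * norm (g 0) < 1 + (norm (g 0))\<^sup>2"
        by (simp add: power2_diff)
      then show "2 * norm (g 0) / d g < (1 + (norm (g 0))\<^sup>2) / d g"
        using d [OF g] by (simp add: divide_strict_right_mono)
    qed fact
    finally show ?thesis .
  qed
  have inv: "F (k z) = F z" if k: "k \<in> \<Gamma>" and z: "z \<in> unit_disc" for k z
  proof -
    have "bij_betw (\<lambda>g. k \<otimes>\<^bsub>Aut_disc\<^esub> g) \<Gamma> \<Gamma>"
    proof (rule bij_betwI [where g = "\<lambda>g. inv\<^bsub>Aut_disc\<^esub> k \<otimes>\<^bsub>Aut_disc\<^esub> g"])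
      show "k \<otimes>\<^bsub>Aut_disc\<^esub> (inv\<^bsub>Aut_disc\<^esub> k \<otimes>\<^bsub>Aut_disc\<^esub> g) = g" if "g \<in> \<Gamma>" for g
        using car [OF k] car [OF that] by (simp flip: A.m_assoc)
      show "inv\<^bsub>Aut_disc\<^esub> k \<otimes>\<^bsub>Aut_disc\<^esub> (k \<otimes>\<^bsub>Aut_disc\<^esub> g) = g" if "g \<in> \<Gamma>" for g
        using car [OF k] car [OF that] by (simp flip: A.m_assoc)
    qed (use k in auto)
    then have "F (k z) =
        (\<Sum>g\<in>\<Gamma>. 1 / (1 - (norm (Moebius_function 0 ((k \<otimes>\<^bsub>Aut_disc\<^esub> g) 0) (k z)))\<^sup>2))"
      unfolding F_def by (rule sum.reindex_bij_betw [symmetric])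
    also have "\<dots> = F z"
      unfolding F_def
    proof (rule sum.cong [OF refl])
      fix g assume g: "g \<in> \<Gamma>"
      have "norm (Moebius_function 0 (k (g 0)) (k z)) = norm (Moebius_function 0 (g 0) z)"
        using car [OF k] n0 [OF g] z by (intro Schwarz_Pick_Aut_disc) auto
      then show "1 / (1 - (norm (Moebius_function 0 ((k \<otimes>\<^bsub>Aut_disc\<^esub> g) 0) (k z)))\<^sup>2) =
          1 / (1 - (norm (Moebius_function 0 (g 0) z))\<^sup>2)"
        using mult [OF k g, of 0] by simp
    qed
    finally show ?thesis .
  qed
  define minimal where "minimal = (\<lambda>a. a \<in> unit_disc \<and> (\<forall>z\<in>unit_disc. Q a \<le> Q z))"
  have "\<exists>!a. minimal a"
    unfolding minimal_def Q_def by (rule ex1_minimum_disc [OF PB])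
  then obtain a where amin: "minimal a" and uniq: "\<And>b. minimal b \<Longrightarrow> b = a"
    by blast
  have a: "a \<in> unit_disc"
    using amin by (simp add: minimal_def)
  have fixed: "g a = a" if g: "g \<in> \<Gamma>" for g
  proof -
    have ga: "g a \<in> unit_disc" using Aut_disc_in_disc [OF car [OF g] a] .
    have "Q (g a) = Q a" using inv [OF g a] FQ [OF ga] FQ [OF a] by simp
    then show ?thesis using amin ga uniq [of "g a"] by (simp add: minimal_def)
  qed
  obtain k where k: "k \<in> \<Gamma>" "k \<noteq> \<one>\<^bsub>Aut_disc\<^esub>"
    using assms(3) \<Gamma>.one_closed by blast
  show ?thesis
  proof (rule ex1I [of _ a])
    show "a \<in> unit_disc \<and> (\<forall>g\<in>\<Gamma>. g a = a)" using a fixed by blast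
    fix b assume b: "b \<in> unit_disc \<and> (\<forall>g\<in>\<Gamma>. g b = b)"
    show "b = a"
    proof (rule ccontr)
      assume "b \<noteq> a"
      with k b a fixed have "k = \<one>\<^bsub>Aut_disc\<^esub>"
        by (intro Aut_disc_two_fixed_points [of k a b] car) auto
      with k show False by simp
    qed
  qed
qed

end

theory Submission
  imports Defs
begin

text \<open>
  Let \<open>a\<close> be the common fixed point, \<open>n\<close> the order of \<open>\<Gamma>\<close>, and \<open>M\<close> the automorphism of the disc
  sending \<open>a\<close> to \<open>0\<close>. By the Schwarz lemma every element of \<open>\<Gamma>\<close> becomes, in the coordinate
  \<open>M\<close>, a rotation by some \<open>\<alpha>\<close>; these multipliers are \<open>n\<close> distinct roots of \<open>\<alpha>\<^sup>n = 1\<close>, hence all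
  of them. So the orbits are the fibres of \<open>z \<mapsto> M(z)\<^sup>n\<close>, a local biholomorphism from the disc
  without \<open>a\<close> onto the disc without \<open>0\<close>, and it descends to the required biholomorphism.
\<close>

section \<open>Plane domains as Riemann surfaces\<close>

lemma second_countable_euclidean: "second_countable (euclidean :: 'a::second_countable_topology topology)"
proof -
  obtain \<B> :: "'a set set" where \<B>: "countable \<B>" "\<And>C. C \<in> \<B> \<Longrightarrow> open C"
    "\<And>U. open U \<Longrightarrow> \<exists>\<U>. \<U> \<subseteq> \<B> \<and> U = \<Union>\<U>"
    using univ_second_countable by blast
  have "\<exists>V\<in>\<B>. x \<in> V \<and> V \<subseteq> U" if "open U" "x \<in> U" for U x
    using \<B>(3) [OF that(1)] that(2) by blast
  then show ?thesis
    using \<B>(1,2) unfolding second_countable_def open_openin [symmetric] by blast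
qed

lemma connected_space_top_of_set: "connected_space (top_of_set S) \<longleftrightarrow> connected S"
  unfolding connectedin_iff_connected [symmetric] connectedin_def by simp

lemma riemann_surface_plane_surface:
  assumes "open T" "connected T" "T \<noteq> {}"
  shows "riemann_surface (plane_surface T)"
proof -
  have "complex_atlas (top_of_set T) {(T, \<lambda>z. z)}"
    unfolding complex_atlas_def using \<open>open T\<close>
    by (auto simp: subtopology_subtopology inv_into_ident homeomorphic_map_id [unfolded id_def]
        intro!: holomorphic_transform [OF holomorphic_on_ident])
  then show ?thesis
    using assms unfolding riemann_surface_def plane_surface_def
    by (simp add: connected_space_top_of_set Hausdorff_space_subtopology
        second_countable_subtopology second_countable_euclidean)
qed

section \<open>Quotients whose orbits are the fibres of a holomorphic map\<close>

text \<open>The action enters through \<open>orbits_eq_fibres\<close>, so questions about the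
  quotient become questions about the single map \<open>p\<close>. Local injectivity makes the
  charts cover the quotient and gives \<open>p\<close> holomorphic local inverses.\<close>

locale orbit_coordinate =
  fixes G :: "(complex \<Rightarrow> complex) monoid" and p :: "complex \<Rightarrow> complex" and S T :: "complex set"
  assumes open_source: "open S" and open_image: "open T"
    and connected_image: "connected T" and image_nonempty: "T \<noteq> {}"
    and holomorphic: "p holomorphic_on S" and onto: "p ` S = T"
    and orbits_eq_fibres: "\<And>z w. z \<in> S \<Longrightarrow> w \<in> S \<Longrightarrow> orbit_map G z = orbit_map G w \<longleftrightarrow> p z = p w"
    and locally_injective: "\<And>z. z \<in> S \<Longrightarrow> \<exists>W. open W \<and> z \<in> W \<and> W \<subseteq> S \<and> inj_on p W"
begin

abbreviation "q \<equiv> orbit_map G"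

abbreviation "Q \<equiv> quotient_top G S"

text \<open>The two halves of the biholomorphism. Representatives are picked by
  \<open>inv_into\<close>; the choice does not affect the value, because orbits and fibres
  coincide.\<close>

definition "descent = p \<circ> inv_into S q"

definition "lift = q \<circ> inv_into S p"

lemma descent_q [simp]: "z \<in> S \<Longrightarrow> descent (q z) = p z"
  using orbits_eq_fibres [of "inv_into S q (q z)" z]
  by (simp add: descent_def inv_into_into f_inv_into_f)

lemma lift_p [simp]: "z \<in> S \<Longrightarrow> lift (p z) = q z"
  using orbits_eq_fibres [of "inv_into S p (p z)" z]
  by (simp add: lift_def inv_into_into f_inv_into_f)

text \<open>Charts are indexed by sets on which the orbit map is injective; this identifies them
  with the sets on which \<open>p\<close> can be inverted.\<close>

lemma inj_on_q_iff: "W \<subseteq> S \<Longrightarrow> inj_on q W \<longleftrightarrow> inj_on p W"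
  unfolding inj_on_def by (intro ball_cong refl) (simp add: subset_iff orbits_eq_fibres)

text \<open>Openness is checked near each point, where \<open>p\<close> is injective and the open
  mapping theorem for injective holomorphic functions applies.\<close>

lemma open_p_image:
  assumes "open W" "W \<subseteq> S"
  shows "open (p ` W)"
proof (rule Topological_Spaces.openI)
  fix y assume "y \<in> p ` W"
  then obtain z where z: "z \<in> W" "y = p z" by blast
  then obtain V where V: "open V" "z \<in> V" "V \<subseteq> S" "inj_on p V"
    using locally_injective assms by blast
  have "open (p ` (V \<inter> W))"
  proof (rule open_mapping_thm3)
    show "p holomorphic_on V \<inter> W" using holomorphic V(3) by (blast intro: holomorphic_on_subset)
    show "open (V \<inter> W)" using V assms by blast
    show "inj_on p (V \<inter> W)" using V(4) by (rule inj_on_subset) blast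
  qed
  then show "\<exists>B. open B \<and> y \<in> B \<and> B \<subseteq> p ` W"
    using z V(2) by (intro exI [of _ "p ` (V \<inter> W)"]) auto
qed

lemma continuous_p: "continuous_map (top_of_set S) (top_of_set T) p"
  using holomorphic onto by (auto simp: continuous_map_in_subtopology holomorphic_on_imp_continuous_on)

lemma quotient_map_p: "quotient_map (top_of_set S) (top_of_set T) p"
proof (rule continuous_open_imp_quotient_map [OF continuous_p])
  show "open_map (top_of_set S) (top_of_set T) p"
    unfolding open_map_def using open_source open_image open_p_image onto
    by (auto simp: openin_open_eq)
qed (simp add: onto)

text \<open>\<open>q\<close> and \<open>p\<close> are quotient maps of \<open>S\<close> with the
  same fibres, so each factors through the other, and continuity of either factor can be tested on
  \<open>S\<close>.\<close>

lemma homeomorphic_maps_descent: "homeomorphic_maps Q (top_of_set T) descent lift"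
  unfolding homeomorphic_maps_def
proof (intro conjI ballI)
  have "continuous_map (top_of_set S) (top_of_set T) (descent \<circ> q)"
    by (rule continuous_map_eq [OF continuous_p]) simp
  then show "continuous_map Q (top_of_set T) descent"
    by (rule continuous_compose_quotient_map [OF quotient_map_orbit_map])
  have "continuous_map (top_of_set S) Q (lift \<circ> p)"
    by (rule continuous_map_eq [OF quotient_imp_continuous_map [OF quotient_map_orbit_map]]) simp
  then show "continuous_map (top_of_set T) Q lift"
    by (rule continuous_compose_quotient_map [OF quotient_map_p])
qed (use onto in \<open>auto simp: topspace_quotient_top\<close>)

lemma homeomorphic_space_image: "Q homeomorphic_space (top_of_set T)"
  using homeomorphic_maps_descent unfolding homeomorphic_space_def by blast

lemma local_inverse_holomorphic:
  assumes "open W" "W \<subseteq> S" "inj_on p W"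
  shows "inv_into W p holomorphic_on p ` W"
proof -
  have "p holomorphic_on W" using holomorphic assms(2) by (rule holomorphic_on_subset)
  then obtain h where "h holomorphic_on p ` W" "\<And>z. z \<in> W \<Longrightarrow> h (p z) = z"
    using holomorphic_has_inverse assms by metis
  then show ?thesis
    using assms(3) by (auto intro: holomorphic_transform)
qed

text \<open>The definitions of atlas and holomorphic map invert charts by \<open>inv_into\<close>. A
  chart is a local inverse of the orbit map, so its inverse is the orbit map again.\<close>

lemma inv_into_chart:
  assumes "inj_on q W" "z \<in> W"
  shows "inv_into (q ` W) (inv_into W q) z = q z"
proof -
  have "inj_on (inv_into W q) (q ` W)" by (rule inj_on_inv_into) simp
  moreover have "inv_into W q (q z) = z" using assms by simp
  ultimately show ?thesis using assms(2) by (metis imageI inv_into_f_f)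
qed

lemma chart_image: "inj_on q W \<Longrightarrow> inv_into W q ` (q ` W) = W"
  by (simp add: inv_into_image_cancel)

text \<open>On \<open>W\<close> the maps \<open>q\<close> and \<open>p\<close> separate the same
  points. Hence a chart, read through \<open>descent\<close>, is a local inverse of
  \<open>p\<close>, which is known to be holomorphic.\<close>

lemma chart_eq:
  assumes "W \<subseteq> S" "inj_on q W" "x \<in> q ` W"
  shows "inv_into W q x = inv_into W p (descent x)"
proof -
  obtain z where z: "z \<in> W" "x = q z" using assms by blast
  then have "descent x = p z" using assms(1) by (simp add: subset_iff)
  moreover have "inj_on p W" using assms(1,2) by (simp add: inj_on_q_iff)
  ultimately show ?thesis using z assms(2) by simp
qed

text \<open>By \<open>chart_eq\<close> the chart is \<open>descent\<close> followed by a continuous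
  local inverse of \<open>p\<close>; its own inverse is the orbit map.\<close>

lemma homeomorphic_map_chart:
  assumes "open W" "W \<subseteq> S" "inj_on q W"
  shows "homeomorphic_map (subtopology Q (q ` W)) (top_of_set W) (inv_into W q)"
proof -
  have inj: "inj_on p W" using assms by (simp add: inj_on_q_iff)
  have sub: "q ` W \<subseteq> topspace Q" using assms(2) by (auto simp: topspace_quotient_top)
  have "continuous_map (subtopology Q (q ` W)) (top_of_set (p ` W)) descent"
    using homeomorphic_maps_descent assms(2) sub
    by (auto simp: homeomorphic_maps_def continuous_map_in_subtopology continuous_map_from_subtopology subset_iff)
  moreover have "continuous_map (top_of_set (p ` W)) (top_of_set W) (inv_into W p)"
    using local_inverse_holomorphic [OF assms(1,2) inj] inj
    by (auto simp: continuous_map_in_subtopology holomorphic_on_imp_continuous_on)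
  ultimately have "continuous_map (subtopology Q (q ` W)) (top_of_set W) (inv_into W p \<circ> descent)"
    by (rule continuous_map_compose)
  then have "continuous_map (subtopology Q (q ` W)) (top_of_set W) (inv_into W q)"
    by (rule continuous_map_eq) (use assms chart_eq in auto)
  moreover have "continuous_map (top_of_set W) (subtopology Q (q ` W)) q"
  proof -
    have "continuous_map (subtopology (top_of_set S) W) Q q"
      by (intro continuous_map_from_subtopology quotient_imp_continuous_map quotient_map_orbit_map)
    then show ?thesis
      using assms(2) by (auto simp: continuous_map_in_subtopology subtopology_subtopology inf.absorb2)
  qed
  ultimately have "homeomorphic_maps (subtopology Q (q ` W)) (top_of_set W) (inv_into W q) q"
    using assms(3) by (auto simp: homeomorphic_maps_def)
  then show ?thesis by (auto simp: homeomorphic_map_maps)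
qed

lemma openin_q_image:
  assumes "open W" "W \<subseteq> S"
  shows "openin Q (q ` W)"
proof -
  have "{z \<in> S. q z \<in> q ` W} = {z \<in> S. p z \<in> p ` W}"
    using assms(2) by (auto simp: image_iff subset_iff orbits_eq_fibres)
  moreover have "openin (top_of_set S) {z \<in> S. p z \<in> p ` W}"
    using openin_continuous_map_preimage [OF continuous_p, of "p ` W"] open_p_image [OF assms] assms onto
      open_image by (auto simp: openin_open_eq)
  ultimately show ?thesis
    using assms(2) by (auto simp: openin_quotient_top)
qed

text \<open>A transition map sends a point of \<open>W\<close> to the point of \<open>V\<close> in
  the same orbit, that is, with the same \<open>p\<close>-value. It is therefore \<open>p\<close>
  followed by its local inverse on \<open>V\<close>.\<close>

lemma complex_atlas_quotient: "complex_atlas Q (charts (quotient_surface G S))"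
proof -
  have "(\<Union>(U, \<phi>)\<in>charts (quotient_surface G S). U) = topspace Q"
  proof (rule antisym)
    show "topspace Q \<subseteq> (\<Union>(U, \<phi>)\<in>charts (quotient_surface G S). U)"
    proof
      fix x assume "x \<in> topspace Q"
      then obtain z where z: "z \<in> S" "x = q z" by (auto simp: topspace_quotient_top)
      then obtain W where "open W" "z \<in> W" "W \<subseteq> S" "inj_on p W"
        using locally_injective by blast
      then show "x \<in> (\<Union>(U, \<phi>)\<in>charts (quotient_surface G S). U)"
        using z inj_on_q_iff [of W] by (auto simp: quotient_surface_def)
    qed
  qed (auto simp: quotient_surface_def topspace_quotient_top)
  moreover have "(inv_into V q \<circ> inv_into (q ` W) (inv_into W q)) holomorphic_on
      inv_into W q ` (q ` W \<inter> q ` V)"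
    if W: "W \<subseteq> S" "open W" "inj_on q W" and V: "V \<subseteq> S" "open V" "inj_on q V" for V W
  proof (rule holomorphic_transform)
    have injV: "inj_on p V" using V by (simp add: inj_on_q_iff)
    have sub: "inv_into W q x \<in> W \<and> p (inv_into W q x) \<in> p ` V" if x: "x \<in> q ` W \<inter> q ` V" for x
    proof -
      obtain z v where z: "z \<in> W" "x = q z" "v \<in> V" "x = q v" using x by blast
      then have "p z = p v" using W V orbits_eq_fibres [of z v] by auto
      then show ?thesis using z W by simp
    qed
    have "p holomorphic_on inv_into W q ` (q ` W \<inter> q ` V)"
      by (rule holomorphic_on_subset [OF holomorphic]) (use sub W in blast)
    then show "(inv_into V p \<circ> p) holomorphic_on inv_into W q ` (q ` W \<inter> q ` V)"
      by (rule holomorphic_on_compose_gen [OF _ local_inverse_holomorphic [OF V(2,1) injV]])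
         (use sub in blast)
    fix z assume "z \<in> inv_into W q ` (q ` W \<inter> q ` V)"
    then obtain x where x: "x \<in> q ` W \<inter> q ` V" "z = inv_into W q x" by blast
    then have z: "z \<in> W" "q z = x" using sub by (auto simp: f_inv_into_f)
    then have "descent x = p z" using W(1) by auto
    then show "(inv_into V p \<circ> p) z = (inv_into V q \<circ> inv_into (q ` W) (inv_into W q)) z"
      using z x(1) W(3) V chart_eq [of V x] by (simp add: inv_into_chart)
  qed
  ultimately show ?thesis
    unfolding complex_atlas_def
    by (auto simp: quotient_surface_def openin_q_image homeomorphic_map_chart chart_image)
qed

text \<open>The topological axioms are invariant under homeomorphism and are inherited from
  \<open>T\<close>.\<close>

lemma riemann_surface_quotient: "riemann_surface (quotient_surface G S)"
proof -
  have "topspace Q \<noteq> {}"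
    using image_nonempty onto by (auto simp: topspace_quotient_top)
  moreover have "connected_space Q" "Hausdorff_space Q" "second_countable Q"
    using homeomorphic_space_image connected_image
    by (simp_all add: homeomorphic_connected_space homeomorphic_Hausdorff_space
        homeomorphic_space_second_countability connected_space_top_of_set
        Hausdorff_space_subtopology second_countable_subtopology second_countable_euclidean)
  ultimately show ?thesis
    using complex_atlas_quotient by (simp add: riemann_surface_def) (simp add: quotient_surface_def)
qed

text \<open>In every chart the coordinate expression of \<open>descent\<close> is \<open>p\<close>
  itself.\<close>

lemma holomorphic_descent:
  "holomorphic_surface_map (quotient_surface G S) (plane_surface T) descent"
proof -
  have "((\<lambda>z. z) \<circ> descent \<circ> inv_into (q ` W) (inv_into W q)) holomorphic_on
      inv_into W q ` {x \<in> q ` W. descent x \<in> T}"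
    if W: "W \<subseteq> S" "open W" "inj_on q W" for W
  proof (rule holomorphic_transform)
    have sub: "inv_into W q ` {x \<in> q ` W. descent x \<in> T} \<subseteq> W"
      by (auto simp: inv_into_into)
    then show "p holomorphic_on inv_into W q ` {x \<in> q ` W. descent x \<in> T}"
      using W by (blast intro: holomorphic_on_subset [OF holomorphic])
    fix z assume "z \<in> inv_into W q ` {x \<in> q ` W. descent x \<in> T}"
    then have "z \<in> W" using sub by blast
    then show "p z = ((\<lambda>z. z) \<circ> descent \<circ> inv_into (q ` W) (inv_into W q)) z"
      using W by (auto simp: inv_into_chart)
  qed
  moreover have "continuous_map Q (top_of_set T) descent"
    using homeomorphic_maps_descent by (simp add: homeomorphic_maps_def)
  ultimately show ?thesis
    unfolding holomorphic_surface_map_def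
    by (auto simp: quotient_surface_def plane_surface_def)
qed

text \<open>In the chart over \<open>W\<close> the coordinate expression of \<open>lift\<close> is
  the local inverse of \<open>p\<close> on \<open>W\<close>.\<close>

lemma holomorphic_lift:
  "holomorphic_surface_map (plane_surface T) (quotient_surface G S) lift"
proof -
  have "(inv_into W q \<circ> lift \<circ> inv_into T (\<lambda>z. z)) holomorphic_on
      (\<lambda>z. z) ` {y \<in> T. lift y \<in> q ` W}"
    if W: "W \<subseteq> S" "open W" "inj_on q W" for W
  proof (rule holomorphic_transform)
    have inj: "inj_on p W" using W by (simp add: inj_on_q_iff)
    have sub: "\<exists>z\<in>W. y = p z" if "y \<in> (\<lambda>z. z) ` {y \<in> T. lift y \<in> q ` W}" for y
    proof -
      have "y \<in> p ` S" unfolding onto using that by auto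
      then obtain w where w: "w \<in> S" "y = p w" by blast
      then have "q w \<in> q ` W" using that by auto
      then obtain z where "z \<in> W" "q w = q z" by blast
      then show ?thesis using w W orbits_eq_fibres [of w z] by auto
    qed
    then show "inv_into W p holomorphic_on (\<lambda>z. z) ` {y \<in> T. lift y \<in> q ` W}"
      by (intro holomorphic_on_subset [OF local_inverse_holomorphic [OF W(2,1) inj]]) blast
    fix y assume y: "y \<in> (\<lambda>z. z) ` {y \<in> T. lift y \<in> q ` W}"
    then obtain z where "z \<in> W" "y = p z" using sub by blast
    then show "inv_into W p y = (inv_into W q \<circ> lift \<circ> inv_into T (\<lambda>z. z)) y"
      using W inj y by (auto simp: inv_into_ident subset_iff)
  qed
  moreover have "continuous_map (top_of_set T) Q lift"
    using homeomorphic_maps_descent by (simp add: homeomorphic_maps_def)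
  ultimately show ?thesis
    unfolding holomorphic_surface_map_def
    by (auto simp: quotient_surface_def plane_surface_def)
qed

lemma biholomorphic_quotient: "biholomorphic_surfaces (quotient_surface G S) (plane_surface T)"
  unfolding biholomorphic_surfaces_def
proof (intro conjI exI)
  show "riemann_surface (plane_surface T)"
    using open_image connected_image image_nonempty by (rule riemann_surface_plane_surface)
  show "\<forall>x\<in>topspace (surf_top (quotient_surface G S)). lift (descent x) = x"
    by (auto simp: quotient_surface_def topspace_quotient_top)
  show "\<forall>y\<in>topspace (surf_top (plane_surface T)). descent (lift y) = y"
    using onto by (auto simp: plane_surface_def)
qed (fact riemann_surface_quotient holomorphic_descent holomorphic_lift)+

end

section \<open>Automorphisms of the disc with a fixed point\<close>

lemma Aut_disc_mult_apply:
  assumes "g \<in> carrier Aut_disc" "k \<in> carrier Aut_disc" "z \<in> unit_disc"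
  shows "(g \<otimes>\<^bsub>Aut_disc\<^esub> k) z = g (k z)"
  using assms by (simp add: carrier_Aut_disc) (simp add: Aut_disc_def BijGroup_def compose_eq)

lemma Aut_disc_one_apply: "z \<in> unit_disc \<Longrightarrow> \<one>\<^bsub>Aut_disc\<^esub> z = z"
  by (simp add: Aut_disc_def BijGroup_def)

text \<open>Conjugating by the Moebius map that moves \<open>a\<close> to 0 gives a self-map
  \<open>h\<close> of the disc fixing 0, and the equality case of the Schwarz lemma makes
  \<open>h\<close> linear.\<close>

lemma Aut_disc_fixing_is_rotation:
  assumes g: "g \<in> carrier Aut_disc" and a: "a \<in> unit_disc" "g a = a"
  obtains \<alpha> where
    "\<And>z. z \<in> unit_disc \<Longrightarrow> Moebius_function 0 a (g z) = \<alpha> * Moebius_function 0 a z"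
proof -
  define M M' where "M = Moebius_function 0 a" and "M' = Moebius_function 0 (- a)"
  define h where "h = M \<circ> (g \<circ> M')"
  have na: "norm a < 1" using a by simp
  have M: "norm (M z) < 1" "norm (M' z) < 1" "M (M' z) = z" "M' (M z) = z" if "norm z < 1" for z
    using that na unfolding M_def M'_def
    by (auto intro!: Moebius_function_norm_lt_1 Moebius_function_compose)
  have hM: "h (M z) = M (g z)" if "norm z < 1" for z
    using M that by (simp add: h_def)
  have into: "norm (g z) < 1" if "norm z < 1" for z
    using Aut_disc_in_disc [OF g, of z] that by simp
  have "(g \<circ> M') holomorphic_on unit_disc"
    by (rule holomorphic_on_compose_gen [of M' unit_disc g unit_disc])
       (use g na M in \<open>auto simp: M'_def carrier_Aut_disc intro!: Moebius_function_holomorphic\<close>)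
  then have "h holomorphic_on unit_disc"
    unfolding h_def
    by (rule holomorphic_on_compose_gen [of _ unit_disc M unit_disc])
       (use na M into in \<open>auto simp: M_def intro!: Moebius_function_holomorphic\<close>)
  moreover have "h 0 = 0"
    using a by (simp add: h_def M_def M'_def Moebius_function_of_zero Moebius_function_eq_zero)
  moreover have "norm (h \<zeta>) < 1" if "norm \<zeta> < 1" for \<zeta>
    using into M that by (simp add: h_def)
  \<comment> \<open>The equality case needs one nonzero point where \<open>h\<close> preserves the
    norm; 1/2 is an arbitrary choice. The norm of \<open>M\<close> is the pseudohyperbolic distance
    from \<open>a\<close>, which \<open>g\<close> preserves.\<close>
  moreover have "norm (h (1/2)) = norm (1/2 :: complex)"
  proof -
    have "norm (M (g (M' (1/2)))) = norm (M (M' (1/2)))"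
      using Schwarz_Pick_Aut_disc [OF g a(1), of "M' (1/2)"] a(2) M(2) [of "1/2"]
      by (simp add: M_def)
    also have "M (M' (1/2)) = 1/2" by (rule M(3)) simp
    finally show ?thesis by (simp add: h_def)
  qed
  moreover have half: "norm (1/2 :: complex) < 1" "1/2 \<noteq> (0 :: complex)" "norm (0 :: complex) < 1"
    by simp_all
  ultimately obtain \<alpha> where "\<And>\<zeta>. norm \<zeta> < 1 \<Longrightarrow> h \<zeta> = \<alpha> * \<zeta>"
    using Schwarz_Lemma(3) [of h 0] half by metis
  then show thesis
    using that [of \<alpha>] hM M by (simp add: M_def)
qed

section \<open>Multipliers of the group and the coordinate \<open>M z ^ n\<close>\<close>

theorem corollary1p8:
  fixes \<Gamma> :: "(complex \<Rightarrow> complex) set"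
  assumes "subgroup \<Gamma> Aut_disc" and "finite \<Gamma>" and "\<Gamma> \<noteq> {\<one>\<^bsub>Aut_disc\<^esub>}"
  shows "biholomorphic_surfaces (regular_part \<Gamma>) (plane_surface (unit_disc - {0}))"
proof -
  interpret A: group Aut_disc by (rule group_Aut_disc)
  interpret \<Gamma>: subgroup \<Gamma> Aut_disc by (rule assms(1))
  define a where "a = common_fixed_point \<Gamma>"
  define n where "n = card \<Gamma>"
  define G where "G = Aut_disc\<lparr>carrier := \<Gamma>\<rparr>"
  define S where "S = unit_disc - {a}"
  define M M' where "M = Moebius_function 0 a" and "M' = Moebius_function 0 (- a)"
  have fix_a: "a \<in> unit_disc \<and> (\<forall>g\<in>\<Gamma>. g a = a)"
    unfolding a_def common_fixed_point_def by (rule theI' [OF ex1_common_fixed_point [OF assms]])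
  then have na: "norm a < 1" by simp
  have n: "n > 0"
    unfolding n_def card_gt_0_iff using assms(2) \<Gamma>.one_closed by blast
  have car: "g \<in> carrier Aut_disc" if "g \<in> \<Gamma>" for g
    using that by (rule \<Gamma>.mem_carrier)
  have M: "norm (M z) < 1" "norm (M' z) < 1" "M (M' z) = z" "M' (M z) = z" if "norm z < 1" for z
    using that na unfolding M_def M'_def
    by (auto intro!: Moebius_function_norm_lt_1 Moebius_function_compose)
  have M_inj: "z = w" if "M z = M w" "norm z < 1" "norm w < 1" for z w
    using that M(4) by metis
  have M0: "M z = 0 \<longleftrightarrow> z = a" if "norm z < 1" for z
    using M_inj [of z a] that na by (auto simp: M_def Moebius_function_eq_zero)
  have into: "norm (g z) < 1" if "g \<in> \<Gamma>" "norm z < 1" for g z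
    using Aut_disc_in_disc [OF car, of g z] that by simp
  have q: "orbit_map G z = {g z | g. g \<in> \<Gamma>}" for z
    by (simp add: orbit_map_def orbit_def G_def)
  have "\<forall>g\<in>\<Gamma>. \<exists>\<alpha>. \<forall>z. norm z < 1 \<longrightarrow> M (g z) = \<alpha> * M z"
  proof
    fix g assume "g \<in> \<Gamma>"
    then show "\<exists>\<alpha>. \<forall>z. norm z < 1 \<longrightarrow> M (g z) = \<alpha> * M z"
      using Aut_disc_fixing_is_rotation [OF car, of g a] fix_a unfolding M_def by (metis mem_ball_0)
  qed
  then obtain \<alpha> where \<alpha>: "\<And>g z. g \<in> \<Gamma> \<Longrightarrow> norm z < 1 \<Longrightarrow> M (g z) = \<alpha> g * M z"
    by metis
  \<comment> \<open>A zero multiplier would make \<open>g\<close> identify the points with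
    \<open>M\<close>-values 0 and 1/2, against injectivity.\<close>
  have \<alpha>0: "\<alpha> g \<noteq> 0" if g: "g \<in> \<Gamma>" for g
  proof
    assume "\<alpha> g = 0"
    define u v where "u = M' 0" and "v = M' (1/2)"
    have uv: "norm u < 1" "norm v < 1" "M u = 0" "M v = 1/2"
      unfolding u_def v_def by (intro M; simp)+
    have "g u = g v"
      by (rule M_inj) (use \<alpha> g uv into \<open>\<alpha> g = 0\<close> in simp_all)
    moreover have "inj_on g unit_disc"
      using car [OF g] by (simp add: carrier_Aut_disc Bij_def bij_betw_def)
    ultimately have "u = v" using uv(1,2) by (simp add: inj_on_eq_iff)
    then show False using uv(3,4) by simp
  qed
  \<comment> \<open>Multipliers can be compared at a single point where \<open>M\<close> does not
    vanish, here the one with \<open>M\<close>-value 1/2.\<close>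
  have \<alpha>_mult: "\<alpha> (g \<otimes>\<^bsub>Aut_disc\<^esub> k) = \<alpha> g * \<alpha> k" if g: "g \<in> \<Gamma>" and k: "k \<in> \<Gamma>" for g k
  proof -
    define z where "z = M' (1/2)"
    have z: "norm z < 1" "M z = 1/2" using M [of "1/2"] by (auto simp: z_def)
    have "\<alpha> (g \<otimes>\<^bsub>Aut_disc\<^esub> k) * M z = M (g (k z))"
      using \<alpha> [of "g \<otimes>\<^bsub>Aut_disc\<^esub> k" z] g k z(1) Aut_disc_mult_apply [OF car car, of g k z] by simp
    also have "\<dots> = \<alpha> g * (\<alpha> k * M z)"
      using \<alpha> into g k z(1) by simp
    finally show ?thesis using z by simp
  qed
  \<comment> \<open>Left multiplication by \<open>g\<close> permutes \<Gamma>, so the product of all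
    multipliers is unchanged when scaled by \<open>\<alpha> g ^ n\<close>; being nonzero, it
    cancels.\<close>
  have \<alpha>_root: "\<alpha> g ^ n = 1" if g: "g \<in> \<Gamma>" for g
  proof -
    have "bij_betw (\<lambda>k. g \<otimes>\<^bsub>Aut_disc\<^esub> k) \<Gamma> \<Gamma>"
    proof (rule bij_betwI [where g = "\<lambda>k. inv\<^bsub>Aut_disc\<^esub> g \<otimes>\<^bsub>Aut_disc\<^esub> k"])
      show "g \<otimes>\<^bsub>Aut_disc\<^esub> (inv\<^bsub>Aut_disc\<^esub> g \<otimes>\<^bsub>Aut_disc\<^esub> k) = k" if "k \<in> \<Gamma>" for k
        using car [OF g] car [OF that] by (simp flip: A.m_assoc)
      show "inv\<^bsub>Aut_disc\<^esub> g \<otimes>\<^bsub>Aut_disc\<^esub> (g \<otimes>\<^bsub>Aut_disc\<^esub> k) = k" if "k \<in> \<Gamma>" for k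
        using car [OF g] car [OF that] by (simp flip: A.m_assoc)
    qed (use g in auto)
    then have "(\<Prod>k\<in>\<Gamma>. \<alpha> k) = (\<Prod>k\<in>\<Gamma>. \<alpha> (g \<otimes>\<^bsub>Aut_disc\<^esub> k))"
      by (rule prod.reindex_bij_betw [symmetric])
    also have "\<dots> = \<alpha> g ^ n * (\<Prod>k\<in>\<Gamma>. \<alpha> k)"
      using \<alpha>_mult [OF g] by (simp add: prod.distrib n_def)
    finally show ?thesis using \<alpha>0 assms(2) by simp
  qed
  \<comment> \<open>Equal multipliers give maps that agree on the disc, as \<open>M\<close> is
    injective; extensionality settles the values outside.\<close>
  have "inj_on \<alpha> \<Gamma>"
  proof (rule inj_onI)
    fix g k assume gk: "g \<in> \<Gamma>" "k \<in> \<Gamma>" "\<alpha> g = \<alpha> k"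
    have "g z = k z" if "z \<in> unit_disc" for z
      by (rule M_inj) (use that gk \<alpha> into in simp_all)
    moreover have "g \<in> extensional unit_disc" "k \<in> extensional unit_disc"
      using car gk by (auto simp: carrier_Aut_disc Bij_def)
    ultimately show "g = k" by (intro extensionalityI)
  qed
  \<comment> \<open>Counting turns the inclusion among the roots of unity into equality. This is
    what keeps a fibre from being larger than an orbit.\<close>
  then have "card (\<alpha> ` \<Gamma>) = card {u::complex. u ^ n = 1}"
    using n by (simp add: card_image card_roots_unity_eq n_def)
  then have roots: "\<alpha> ` \<Gamma> = {u. u ^ n = 1}"
    using \<alpha>_root n by (intro card_subset_eq finite_roots_unity) auto
  have q_inv: "orbit_map G z = orbit_map G w \<longleftrightarrow> M z ^ n = M w ^ n"
    if z: "z \<in> S" and w: "w \<in> S" for z w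
  proof
    have nz: "norm z < 1" "norm w < 1" using z w by (auto simp: S_def)
    {
      assume "orbit_map G z = orbit_map G w"
      moreover have "z \<in> orbit_map G z"
        unfolding q using Aut_disc_one_apply [of z] nz(1)
        by (intro CollectI exI [of _ "\<one>\<^bsub>Aut_disc\<^esub>"]) simp
      ultimately obtain g where "g \<in> \<Gamma>" "z = g w" by (auto simp: q)
      then show "M z ^ n = M w ^ n"
        using \<alpha> \<alpha>_root nz by (simp add: power_mult_distrib)
    next
      assume eq: "M z ^ n = M w ^ n"
      \<comment> \<open>Since \<open>a\<close> is removed from \<open>S\<close>, the quotient
        \<open>M z / M w\<close> makes sense. It is a root of unity, hence the multiplier of some
        \<open>g\<close>, and this \<open>g\<close> carries \<open>w\<close> to
        \<open>z\<close>.\<close>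
      have Mw: "M w \<noteq> 0" using M0 w nz by (auto simp: S_def)
      then have "(M z / M w) ^ n = 1" using eq by (simp add: power_divide)
      then have "M z / M w \<in> \<alpha> ` \<Gamma>" unfolding roots by (rule CollectI)
      then obtain g where g: "g \<in> \<Gamma>" "\<alpha> g = M z / M w" by (metis imageE)
      then have "M (g w) = M z" using \<alpha> nz Mw by simp
      then have gw: "g w = z" using into [OF g(1) nz(2)] nz(1) by (rule M_inj)
      have ginv: "inv\<^bsub>Aut_disc\<^esub> g \<in> \<Gamma>" using g by simp
      have "w = (inv\<^bsub>Aut_disc\<^esub> g \<otimes>\<^bsub>Aut_disc\<^esub> g) w"
        using car [OF g(1)] nz by (simp add: Aut_disc_one_apply)
      then have gz: "(inv\<^bsub>Aut_disc\<^esub> g) z = w"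
        using Aut_disc_mult_apply [OF car [OF ginv] car [OF g(1)], of w] nz gw by simp
      \<comment> \<open>Applied to \<open>g\<close> at \<open>w\<close> and to its inverse at
        \<open>z\<close>, this yields the two inclusions between the orbits.\<close>
      have sub: "orbit_map G (h y) \<subseteq> orbit_map G y" if "h \<in> \<Gamma>" "norm y < 1" for h y
      proof
        fix x assume "x \<in> orbit_map G (h y)"
        then obtain k where k: "k \<in> \<Gamma>" "x = k (h y)" by (auto simp: q)
        then have "x = (k \<otimes>\<^bsub>Aut_disc\<^esub> h) y"
          using Aut_disc_mult_apply [OF car car, of k h y] that by simp
        then show "x \<in> orbit_map G y" using k that by (auto simp: q)
      qed
      show "orbit_map G z = orbit_map G w"
        using sub [OF g(1) nz(2)] sub [OF ginv nz(1)] gw gz by simp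
    }
  qed
  have S: "open S" by (auto simp: S_def)
  have M_hol: "M holomorphic_on unit_disc"
    using Moebius_function_holomorphic na by (simp add: M_def)
  have p_hol: "(\<lambda>z. M z ^ n) holomorphic_on S"
    using M_hol by (intro holomorphic_intros) (auto simp: S_def intro: holomorphic_on_subset)
  interpret orbit_coordinate G "\<lambda>z. M z ^ n" S "unit_disc - {0}"
  proof
    show "connected (unit_disc - {0 :: complex})"
      by (rule connected_open_diff_countable) auto
    have "1/2 \<in> unit_disc - {0 :: complex}" by simp
    then show "unit_disc - {0 :: complex} \<noteq> {}" by blast
    show "(\<lambda>z. M z ^ n) ` S = unit_disc - {0}"
    proof (intro antisym subsetI)
      fix y assume "y \<in> (\<lambda>z. M z ^ n) ` S"
      then show "y \<in> unit_disc - {0}"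
        using M(1) M0 n by (auto simp: S_def norm_power power_less_one_iff)
    next
      fix y :: complex assume y: "y \<in> unit_disc - {0}"
      \<comment> \<open>A preimage of \<open>y\<close> is found by taking any \<open>n\<close>-th
        root, which is again nonzero and in the disc, and moving it back by
        \<open>M'\<close>.\<close>
      obtain u where u: "u ^ n = y"
        using n exists_complex_root [of n y] by (metis neq0_conv)
      then have "norm u ^ n < 1" "u \<noteq> 0"
        using y n by (auto simp: norm_power [symmetric] power_0_left)
      then have nu: "norm u < 1" using n by (simp add: power_less_one_iff)
      then have "M' u \<in> S" using M [OF nu] M0 [of "M' u"] \<open>u \<noteq> 0\<close> by (auto simp: S_def)
      moreover have "y = M (M' u) ^ n" using M(3) [OF nu] u by simp
      ultimately show "y \<in> (\<lambda>z. M z ^ n) ` S" by blast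
    qed
    show "\<exists>W. open W \<and> z \<in> W \<and> W \<subseteq> S \<and> inj_on (\<lambda>z. M z ^ n) W" if z: "z \<in> S" for z
    proof -
      have nz: "z \<in> unit_disc" using z by (simp add: S_def)
      \<comment> \<open>The derivative of \<open>M z ^ n\<close> vanishes only where
        \<open>deriv M\<close> or, for \<open>n > 1\<close>, \<open>M\<close> does. Injectivity of
        \<open>M\<close> excludes the former, and removing \<open>a\<close> the latter.\<close>
      have "inj_on M unit_disc" using M_inj by (auto intro: inj_onI)
      then have d: "deriv M z \<noteq> 0"
        using holomorphic_injective_imp_regular [OF M_hol] nz by blast
      have "(M has_field_derivative deriv M z) (at z)"
        using holomorphic_derivI [OF M_hol open_ball nz] .
      then have "((\<lambda>z. M z ^ n) has_field_derivative of_nat n * M z ^ (n - 1) * deriv M z) (at z)"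
        by (auto intro!: derivative_eq_intros)
      then have "deriv (\<lambda>z. M z ^ n) z = of_nat n * M z ^ (n - 1) * deriv M z"
        by (rule DERIV_imp_deriv)
      moreover have "M z \<noteq> 0" using M0 z by (auto simp: S_def)
      ultimately have "deriv (\<lambda>z. M z ^ n) z \<noteq> 0" using d n by simp
      then obtain r where "r > 0" "ball z r \<subseteq> S" "inj_on (\<lambda>z. M z ^ n) (ball z r)"
        using has_complex_derivative_locally_injective [OF p_hol z S] by blast
      then show ?thesis by (intro exI [of _ "ball z r"]) auto
    qed
  qed (use S p_hol q_inv in auto)
  show ?thesis
    using biholomorphic_quotient by (simp add: regular_part_def G_def S_def a_def)
qed

end
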